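(* Let $f:\mathbb{N}\to\mathbb{C}$ with $f(k)\neq 0$ for all $k\geq 1$, and let $t\in\mathbb{C}$, $t\neq 0$. Then for all integers $n\geq 0$: \begin{align*} \genfrac{[}{]}{0pt}{}{n+1}{2}_{f(t)} &= \frac{n!_f}{t^{n(n+1)/2}}\, F_n^{(1)}(t),\\ \genfrac{[}{]}{0pt}{}{n+1}{3}_{f(t)} &= \frac{n!_f}{2\,t^{n(n+1)/2}}\left(F_n^{(1)}(t)^2 - F_n^{(2)}(t^2)\right),\\ \genfrac{[}{]}{0pt}{}{n+1}{4}_{f(t)} &= \frac{n!_f}{6\,t^{n(n+1)/2}}\left(F_n^{(1)}(t)^3 - 3F_n^{(1)}(t)F_n^{(2)}(t^2) + 2F_n^{(3)}(t^3)\right),\\ \genfrac{[}{]}{0pt}{}{n+1}{5}_{f(t)} &= \frac{n!_f}{24\,t^{n(n+1)/2}}\left(F_n^{(1)}(t)^4 - 6F_n^{(1)}(t)^2F_n^{(2)}(t^2) + 3F_n^{(2)}(t^2)^2 + 8F_n^{(1)}(t)F_n^{(3)}(t^3) - 6F_n^{(4)}(t^4)\right). \end{align*}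
   Context: Generalized Stirling numbers of the first kind: for $f:\mathbb{N}\to\mathbb{C}$, nonzero $t\in\mathbb{C}$ and integers $n,k\geq 1$, $$\genfrac{[}{]}{0pt}{}{n}{k}_{f(t)} := [x^{k-1}]\prod_{j=1}^{n-1}\left(x+\frac{f(j)}{t^j}\right),$$ the coefficient of $x^{k-1}$ in the product (the empty product is $1$); also $\genfrac{[}{]}{0pt}{}{0}{0}_{f(t)}=1$, and $\genfrac{[}{]}{0pt}{}{n}{0}_{f(t)}=0=\genfrac{[}{]}{0pt}{}{0}{n}_{f(t)}$ for $n\geq 1$. Equivalently, for $n,k\ge 1$ they satisfy $\genfrac{[}{]}{0pt}{}{n}{k}_{f(t)} = f(n-1)\,t^{1-n}\genfrac{[}{]}{0pt}{}{n-1}{k}_{f(t)}+\genfrac{[}{]}{0pt}{}{n-1}{k-1}_{f(t)}$. The $f$-factorial is $n!_f := \prod_{j=1}^n f(j)$ (with $0!_f=1$). The $p$-order $f$-harmonic numbers are $F_n^{(p)}(t) := \sum_{k=1}^{n}\frac{t^k}{f(k)^p}$ (with $F_0^{(p)}(t)=0$); thus $F_n^{(p)}(t^p)=\sum_{k=1}^n \frac{t^{pk}}{f(k)^p}$. *)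

theory Defs
  imports Complex_Main "HOL-Computational_Algebra.Polynomial"
begin

text \<open>
  The polynomial \<open>[:c, 1:]\<close> is $x + c$, so the third case is the coefficient of $x^{k-1}$ in
  $\prod_{j=1}^{n-1} (x + f(j)/t^j)$. The value \<open>f 0\<close> is never used.
\<close>

definition gen_stirling1 :: "(nat \<Rightarrow> complex) \<Rightarrow> complex \<Rightarrow> nat \<Rightarrow> nat \<Rightarrow> complex" where
  "gen_stirling1 f t n k =
     (if n = 0 \<and> k = 0 then 1
      else if n = 0 \<or> k = 0 then 0
      else coeff (\<Prod>j=1..n-1. [:f j / t ^ j, 1:]) (k - 1))"

definition f_fact :: "(nat \<Rightarrow> complex) \<Rightarrow> nat \<Rightarrow> complex" where
  "f_fact f n = (\<Prod>j=1..n. f j)"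

definition f_harmonic :: "(nat \<Rightarrow> complex) \<Rightarrow> nat \<Rightarrow> nat \<Rightarrow> complex \<Rightarrow> complex" where
  "f_harmonic f p n t = (\<Sum>k=1..n. t ^ k / f k ^ p)"

lemma gen_stirling1_rec:
  assumes "n \<ge> 1" "k \<ge> 1"
  shows "gen_stirling1 f t n k =
           f (n - 1) / t ^ (n - 1) * gen_stirling1 f t (n - 1) k + gen_stirling1 f t (n - 1) (k - 1)"
proof (cases "n = 1")
  case True
  then show ?thesis
    using assms by (auto simp: gen_stirling1_def)
next
  case False
  then obtain m where n: "n = Suc (Suc m)"
    using assms by (metis One_nat_def not0_implies_Suc not_one_le_zero)
  obtain l where k: "k = Suc l"
    using assms by (cases k) auto
  show ?thesis
    unfolding n k by (cases l) (auto simp: gen_stirling1_def mult.commute coeff_pCons)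
qed

end

theory Submission
  imports Defs
begin

text \<open>
  Write \<open>f j / t ^ j = 1 / y j\<close>, which is legitimate since \<open>f\<close> does not vanish.
  Pulling the constant term out of every factor,
  \[ \prod_{j=1}^n \Bigl(x + \frac{f(j)}{t^j}\Bigr)
     = \frac{n!_f}{t^{n(n+1)/2}} \prod_{j=1}^n (1 + y_j x), \]
  so up to this prefactor the Stirling numbers with lower index $2, 3, \dots$ are the elementary symmetric polynomials
  $e_1, e_2, \dots$ of the $y_j = t^j / f(j)$, while the harmonic numbers $F_n^{(p)}(t^p)$ are their power sums
  $p_p$.  The four formulas are therefore the classical expressions of $e_1, \dots, e_4$ in
  power sums; they follow by solving the Newton identities
  $k e_k = \sum_{i=1}^{k} (-1)^{i-1} e_{k-i} p_i$ (lemma \<open>newton_identity\<close>) successively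
  for $k = 1, \dots, 4$.
\<close>

lemma coeff_linear_mult:
  fixes q :: "'a::comm_semiring_1 poly"
  shows "coeff ([:1, c:] * q) 0 = coeff q 0"
    and "coeff ([:1, c:] * q) (Suc m) = coeff q (Suc m) + c * coeff q m"
  by (simp_all add: coeff_pCons)

text \<open>
  This compares coefficients in $(1 + cx)q \cdot c\,(1 - cx + c^2x^2 - \cdots) = c\,q$: the
  alternating powers of \<open>c\<close> divide the factor $1 + cx$ out again.
\<close>

lemma sum_geometric_coeff_linear_mult:
  fixes q :: "'a::comm_ring_1 poly"
  shows "(\<Sum>i\<le>k. (-1) ^ i * coeff ([:1, c:] * q) (k - i) * c ^ Suc i) = c * coeff q k"
proof (induction k)
  case 0
  show ?case by (simp add: coeff_linear_mult)
next
  case (Suc k)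
  have "(\<Sum>i\<le>Suc k. (-1) ^ i * coeff ([:1, c:] * q) (Suc k - i) * c ^ Suc i)
      = coeff ([:1, c:] * q) (Suc k) * c
        - c * (\<Sum>i\<le>k. (-1) ^ i * coeff ([:1, c:] * q) (k - i) * c ^ Suc i)"
    by (simp only: sum.atMost_Suc_shift)
       (simp add: sum_distrib_left sum_negf mult_ac del: mult_pCons_left)
  also have "\<dots> = c * coeff q (Suc k)"
    unfolding Suc.IH by (simp add: coeff_linear_mult algebra_simps)
  finally show ?case .
qed

text \<open>
  Adjoining a value \<open>y a\<close> changes both the elementary symmetric polynomials and the power
  sums.  The old power sums against the new coefficients give
  $(k+1) e_{k+1} + y_a\,k\,e_k$ by the induction hypothesis for $k+1$ and for $k$, and the new powers
  of \<open>y a\<close> contribute the missing $y_a e_k$.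
\<close>

lemma newton_identity:
  fixes y :: "'b \<Rightarrow> 'a::comm_ring_1"
  assumes "finite A"
  shows "of_nat (Suc k) * coeff (\<Prod>j\<in>A. [:1, y j:]) (Suc k)
       = (\<Sum>i\<le>k. (-1) ^ i * coeff (\<Prod>j\<in>A. [:1, y j:]) (k - i) * (\<Sum>j\<in>A. y j ^ Suc i))"
  using assms
proof (induction A arbitrary: k rule: finite_induct)
  case empty
  show ?case by simp
next
  case (insert a A)
  define q where "q = (\<Prod>j\<in>A. [:1, y j:])"
  define p where "p i = (\<Sum>j\<in>A. y j ^ Suc i)" for i
  have IH: "of_nat (Suc k) * coeff q (Suc k) = (\<Sum>i\<le>k. (-1) ^ i * coeff q (k - i) * p i)" for k
    using insert.IH by (simp only: q_def p_def)
  have old: "(\<Sum>i\<le>k. (-1) ^ i * coeff ([:1, y a:] * q) (k - i) * p i)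
      = of_nat (Suc k) * coeff q (Suc k) + y a * (of_nat k * coeff q k)"
  proof (cases k)
    case 0
    then show ?thesis using IH[of 0] by (simp add: coeff_linear_mult)
  next
    case (Suc m)
    have "(-1) ^ i * coeff ([:1, y a:] * q) (k - i) * p i
        = (-1) ^ i * coeff q (k - i) * p i + y a * ((-1) ^ i * coeff q (m - i) * p i)"
      if "i \<le> m" for i
      using that unfolding Suc
      by (simp only: Suc_diff_le coeff_linear_mult) (simp add: algebra_simps)
    moreover have "coeff ([:1, y a:] * q) 0 = coeff q 0"
      by (rule coeff_linear_mult)
    ultimately have "(\<Sum>i\<le>k. (-1) ^ i * coeff ([:1, y a:] * q) (k - i) * p i)
        = (\<Sum>i\<le>k. (-1) ^ i * coeff q (k - i) * p i)
          + y a * (\<Sum>i\<le>m. (-1) ^ i * coeff q (m - i) * p i)"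
      by (simp add: Suc sum.distrib sum_distrib_left del: mult_pCons_left)
    then show ?thesis
      by (simp only: IH[symmetric] Suc)
  qed
  have "(\<Sum>i\<le>k. (-1) ^ i * coeff ([:1, y a:] * q) (k - i) * (y a ^ Suc i + p i))
      = y a * coeff q k + (of_nat (Suc k) * coeff q (Suc k) + y a * (of_nat k * coeff q k))"
    unfolding distrib_left sum.distrib old sum_geometric_coeff_linear_mult ..
  also have "\<dots> = of_nat (Suc k) * coeff ([:1, y a:] * q) (Suc k)"
    by (simp only: coeff_linear_mult) (simp add: algebra_simps)
  finally show ?case
    using insert.hyps by (simp add: p_def q_def del: mult_pCons_left power_Suc of_nat_Suc)
qed

text \<open>
  Each formula is the Newton identity for that coefficient with the previous formulas
  substituted, so the denominator accumulates to $k!$; dividing by it is why characteristic zero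
  is required.
\<close>

lemma coeff_prod_linear_power_sums:
  fixes y :: "'b \<Rightarrow> 'a::field_char_0" and A :: "'b set"
  defines "e \<equiv> coeff (\<Prod>j\<in>A. [:1, y j:])" and "p \<equiv> \<lambda>i. \<Sum>j\<in>A. y j ^ i"
  assumes "finite A"
  shows "e 1 = p 1"
    and "e 2 = ((p 1)^2 - p 2) / 2"
    and "e 3 = ((p 1)^3 - 3 * p 1 * p 2 + 2 * p 3) / 6"
    and "e 4 = ((p 1)^4 - 6 * (p 1)^2 * p 2 + 3 * (p 2)^2 + 8 * p 1 * p 3 - 6 * p 4) / 24"
proof -
  have newton: "of_nat (Suc k) * e (Suc k) = (\<Sum>i\<le>k. (-1) ^ i * e (k - i) * p (Suc i))" for k
    unfolding e_def p_def by (rule newton_identity[OF \<open>finite A\<close>])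
  have e0: "e 0 = 1"
    by (simp add: e_def poly_0_coeff_0[symmetric] poly_prod)
  show e1: "e 1 = p 1"
    using newton[of 0] e0 by simp
  have "2 * e 2 = e 1 * p 1 - p 2"
    using newton[of 1] e0 by (simp add: numeral_eq_Suc)
  then show e2: "e 2 = ((p 1)^2 - p 2) / 2"
    unfolding e1 by (simp add: field_simps power2_eq_square)
  have "3 * e 3 = e 2 * p 1 - e 1 * p 2 + p 3"
    using newton[of 2] e0 by (simp add: numeral_eq_Suc)
  then show e3: "e 3 = ((p 1)^3 - 3 * p 1 * p 2 + 2 * p 3) / 6"
    unfolding e1 e2 by (simp add: field_simps power2_eq_square power3_eq_cube)
  have "4 * e 4 = e 3 * p 1 - e 2 * p 2 + e 1 * p 3 - p 4"
    using newton[of 3] e0 by (simp add: numeral_eq_Suc)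
  moreover have "24 * e 4 = 6 * (4 * e 4)"
    by simp
  ultimately have "24 * e 4 = 6 * (e 3 * p 1 - e 2 * p 2 + e 1 * p 3 - p 4)"
    by (simp only:)
  also have "\<dots> = (p 1)^4 - 6 * (p 1)^2 * p 2 + 3 * (p 2)^2 + 8 * p 1 * p 3 - 6 * p 4"
    unfolding e1 e2 e3
    by (simp add: field_simps power2_eq_square power3_eq_cube power4_eq_xxxx)
  finally show "e 4 = ((p 1)^4 - 6 * (p 1)^2 * p 2 + 3 * (p 2)^2 + 8 * p 1 * p 3 - 6 * p 4) / 24"
    by (simp add: field_simps)
qed

lemma prod_f_div_power:
  "(\<Prod>j=1..n. f j / t ^ j) = f_fact f n / t ^ (n * (n + 1) div 2)"
proof -
  have "(\<Prod>j=1..n. t ^ j) = t ^ (\<Sum>j=1..n. j)"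
    by (simp only: power_sum)
  also have "(\<Sum>j=1..n. j) = n * (n + 1) div 2"
    using gauss_sum_from_Suc_0[of n, where 'a = nat] by simp
  finally show ?thesis
    by (simp only: f_fact_def prod_dividef)
qed

lemma f_harmonic_eq_power_sum:
  "f_harmonic f p n (t ^ p) = (\<Sum>j=1..n. (t ^ j / f j) ^ p)"
  unfolding f_harmonic_def
  by (simp add: power_divide power_mult[symmetric] mult.commute)

text \<open>
  In the values $a = f(j)/t^j$, the coefficient of $x^k$ is elementary symmetric of degree $n - k$, which
  grows with \<open>n\<close>.  Writing every factor as $x + a = a\,(1 + x/a)$ makes it elementary symmetric
  of the fixed degree \<open>k\<close> in the reciprocals $1/a$, and these are the summands of the harmonic
  numbers.
\<close>

lemma gen_stirling1_eq_coeff_reciprocals: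
  assumes "\<And>k. k \<ge> 1 \<Longrightarrow> f k \<noteq> 0" and "t \<noteq> 0"
  shows "gen_stirling1 f t (n + 1) (Suc k)
       = f_fact f n / t ^ (n * (n + 1) div 2) * coeff (\<Prod>j=1..n. [:1, t ^ j / f j:]) k"
proof -
  have "(\<Prod>j=1..n. [:f j / t ^ j, 1:])
      = (\<Prod>j=1..n. [:f j / t ^ j:] * [:1, t ^ j / f j:])"
    using assms by (intro prod.cong) auto
  also have "\<dots> = [:\<Prod>j=1..n. f j / t ^ j:] * (\<Prod>j=1..n. [:1, t ^ j / f j:])"
  proof -
    have "(\<Prod>j\<in>A. [:g j:]) = [:\<Prod>j\<in>A. g j:]" for g :: "nat \<Rightarrow> complex" and A
      by (induction A rule: infinite_finite_induct) (simp_all add: one_pCons)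
    then show ?thesis
      by (simp only: prod.distrib)
  qed
  finally show ?thesis
    unfolding gen_stirling1_def prod_f_div_power by simp
qed

theorem corollary2p2:
  fixes f :: "nat \<Rightarrow> complex" and t :: complex and n :: nat
  assumes "\<And>k. k \<ge> 1 \<Longrightarrow> f k \<noteq> 0" and "t \<noteq> 0"
  shows "gen_stirling1 f t (n + 1) 2 =
           f_fact f n / t ^ (n * (n + 1) div 2) * f_harmonic f 1 n t \<and>
         gen_stirling1 f t (n + 1) 3 =
           f_fact f n / (2 * t ^ (n * (n + 1) div 2)) *
             ((f_harmonic f 1 n t)^2 - f_harmonic f 2 n (t^2)) \<and>
         gen_stirling1 f t (n + 1) 4 =
           f_fact f n / (6 * t ^ (n * (n + 1) div 2)) *
             ((f_harmonic f 1 n t)^3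
              - 3 * f_harmonic f 1 n t * f_harmonic f 2 n (t^2)
              + 2 * f_harmonic f 3 n (t^3)) \<and>
         gen_stirling1 f t (n + 1) 5 =
           f_fact f n / (24 * t ^ (n * (n + 1) div 2)) *
             ((f_harmonic f 1 n t)^4
              - 6 * (f_harmonic f 1 n t)^2 * f_harmonic f 2 n (t^2)
              + 3 * (f_harmonic f 2 n (t^2))^2
              + 8 * f_harmonic f 1 n t * f_harmonic f 3 n (t^3)
              - 6 * f_harmonic f 4 n (t^4))"
proof -
  have stirling: "gen_stirling1 f t (n + 1) (Suc k)
      = f_fact f n / t ^ (n * (n + 1) div 2) * coeff (\<Prod>j=1..n. [:1, t ^ j / f j:]) k" for k
    using assms by (rule gen_stirling1_eq_coeff_reciprocals)
  note power_sums = coeff_prod_linear_power_sums[OF finite_atLeastAtMost[of 1 n],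
      where y = "\<lambda>j. t ^ j / f j", folded f_harmonic_eq_power_sum, unfolded power_one_right]
  show ?thesis
    using stirling[of 1] stirling[of 2] stirling[of 3] stirling[of 4]
    unfolding power_sums by (simp add: numeral_eq_Suc)
qed

end
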